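(* Let $(X,d)$ be a complete metric space, and let $T:X\to\mathcal{CB}(X)$ be a multi-valued mapping such that $$\mathcal{H}(Tx,Ty)\leq d(x,y)-\theta(d(x,y))$$ for all $x,y\in X$ with $x\neq y$, where $\theta:(0,\infty)\to(0,\infty)$ is an upper semicontinuous map such that $t\mapsto\frac{\theta(t)}{t}$ is non-increasing on $(0,+\infty)$. Then $T$ has a fixed point.
   Context: $\mathcal{CB}(X)$ denotes the family of all nonempty closed and bounded subsets of $X$, and $\mathcal{H}$ is the Hausdorff metric on $\mathcal{CB}(X)$ induced by $d$: $\mathcal{H}(A,B)=\max\{\sup_{x\in B}d(x,A),\ \sup_{x\in A}d(x,B)\}$, where $d(x,A)=\inf_{a\in A}d(x,a)$. A fixed point of $T:X\to\mathcal{CB}(X)$ is a point $v\in X$ with $v\in Tv$. *)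

theory Defs
  imports "HOL-Analysis.Analysis"
begin

definition CB :: "'a::metric_space set set" where
  "CB = {A. A \<noteq> {} \<and> closed A \<and> bounded A}"

text \<open>
  The suprema are taken in the reals, so \<open>hausdorff_dist A B\<close> has its usual meaning
  for \<open>A\<close> and \<open>B\<close> in \<^const>\<open>CB\<close>: both index sets are then nonempty, and both
  families of distances are bounded. For the same reason the convention
  \<open>infdist x {} = 0\<close> plays no role there.
\<close>

definition hausdorff_dist :: "'a::metric_space set \<Rightarrow> 'a set \<Rightarrow> real" where
  "hausdorff_dist A B = max (SUP x\<in>B. infdist x A) (SUP x\<in>A. infdist x B)"

text \<open>Upper semicontinuity with respect to the subspace topology of \<open>S\<close>.\<close>

definition upper_semicontinuous_on :: "'a::topological_space set \<Rightarrow> ('a \<Rightarrow> real) \<Rightarrow> bool" where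
  "upper_semicontinuous_on S f \<longleftrightarrow>
     (\<forall>x\<in>S. \<forall>c>f x. \<forall>\<^sub>F y in at x within S. f y < c)"

end

theory Submission
  imports Defs
begin

text \<open>
  Monotonicity of \<open>\<theta> t / t\<close> bounds this ratio from below by a positive constant \<open>c\<close> on every
  interval \<open>(0, \<delta>]\<close>, namely by its value at \<open>\<delta>\<close>. Hence \<open>T\<close> is a contraction with ratio \<open>1 - c\<close>
  on all pairs of points at distance at most \<open>\<delta>\<close>. Take \<open>\<delta>\<close> to be the length of a first
  step from some \<open>x0\<close> to a point \<open>x1 \<noteq> x0\<close> of \<open>T x0\<close>. Nadler's iteration, in which each point is chosen
  in the image of its predecessor almost as near as the Hausdorff distance permits, then makes
  geometrically decreasing steps, and these never leave the scale \<open>\<delta>\<close> at which the contraction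
  is available. The orbit therefore converges, and its limit is a fixed point because the images
  are closed (\<open>fixed_point_if_contraction_at_small_scale\<close>).
\<close>

lemma Cauchy_if_summable_dist:
  fixes x :: "nat \<Rightarrow> 'a::metric_space"
  assumes "summable (\<lambda>n. dist (x n) (x (Suc n)))"
  shows "Cauchy x"
proof (rule metric_CauchyI)
  fix e :: real
  assume "e > 0"
  define d where "d n = dist (x n) (x (Suc n))" for n
  obtain N where N: "\<And>m n. m \<ge> N \<Longrightarrow> norm (sum d {m..<n}) < e / 2"
    using assms \<open>e > 0\<close> unfolding summable_Cauchy d_def by (meson half_gt_zero)
  have le_sum: "dist (x m) (x n) \<le> sum d {m..<n}" if "m \<le> n" for m n
    using that
  proof (induction n rule: dec_induct)
    case (step n)
    have "dist (x m) (x (Suc n)) \<le> dist (x m) (x n) + d n"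
      unfolding d_def by (rule dist_triangle)
    with step show ?case by simp
  qed simp
  have tail: "dist (x N) (x n) < e / 2" if "n \<ge> N" for n
    using le_sum[OF that] N[of N n] by simp
  have "dist (x m) (x n) < e" if "m \<ge> N" "n \<ge> N" for m n
    using tail[OF that(1)] tail[OF that(2)] dist_triangle3[of "x m" "x n" "x N"] by linarith
  then show "\<exists>M. \<forall>m\<ge>M. \<forall>n\<ge>M. dist (x m) (x n) < e" by blast
qed

text \<open>
  The supremum in \<^const>\<open>hausdorff_dist\<close> is a real one, and it is taken over a bounded family
  because, for any \<open>b \<in> B\<close>, the distances to \<open>B\<close> are at most those to \<open>b\<close>, and \<open>A\<close> is bounded.
\<close>
lemma infdist_le_hausdorff_dist:
  assumes A: "A \<in> CB" and B: "B \<in> CB" and y: "y \<in> A"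
  shows "infdist y B \<le> hausdorff_dist A B"
proof -
  obtain b where b: "b \<in> B" using B by (auto simp: CB_def)
  have "bounded A" using A by (simp add: CB_def)
  then obtain e where e: "\<And>a. a \<in> A \<Longrightarrow> dist b a \<le> e"
    unfolding bounded_any_center[of A b] by blast
  have "bdd_above ((\<lambda>a. infdist a B) ` A)"
  proof (rule bdd_aboveI2)
    fix a assume "a \<in> A"
    then show "infdist a B \<le> e"
      using infdist_le[OF b, of a] e[of a] by (simp add: dist_commute)
  qed
  then have "infdist y B \<le> (SUP a\<in>A. infdist a B)"
    using y by (rule cSUP_upper2) simp
  then show ?thesis by (simp add: hausdorff_dist_def)
qed

lemma ex_dist_less_if_infdist_less:
  assumes "B \<noteq> {}" "infdist y B < e"
  obtains z where "z \<in> B" "dist y z < e"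
  using assms cInf_lessD[of "dist y ` B" e] by (auto simp: infdist_notempty)

text \<open>
  A version of Nadler's theorem localised to the scale of the first step of an orbit. It suffices
  to contract at this scale because later steps are shorter, and because the argument at the limit
  uses points of the orbit that are already close to it.
\<close>
lemma fixed_point_if_contraction_at_small_scale:
  fixes T :: "'a::complete_space \<Rightarrow> 'a set"
  assumes T_CB: "\<And>x. T x \<in> CB"
    and k: "0 \<le> k" "k < 1"
    and contr: "\<And>x y. x \<noteq> y \<Longrightarrow> dist x y \<le> \<delta> \<Longrightarrow>
      hausdorff_dist (T x) (T y) \<le> k * dist x y"
    and start: "x1 \<in> T x0" "dist x0 x1 \<le> \<delta>"
  shows "\<exists>v. v \<in> T v"
proof (cases "\<delta> > 0")
  case False
  then have "dist x0 x1 \<le> 0" using start(2) by linarith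
  then have "x0 = x1" by simp
  with start(1) show ?thesis by blast
next
  case True
  \<comment> \<open>A ratio strictly above \<open>k\<close> leaves room to choose the next point, since the distance to an
    image need not be attained.\<close>
  define r where "r = (1 + k) / 2"
  have r: "0 < r" "r < 1" "k < r" using k by (auto simp: r_def)
  define P where "P n p \<longleftrightarrow> snd p \<in> T (fst p) \<and> dist (fst p) (snd p) \<le> \<delta> * r ^ n"
    for n :: nat and p :: "'a \<times> 'a"
  have "\<exists>q. P (Suc n) q \<and> fst q = snd p" if "P n p" for n p
  proof -
    obtain x y where p: "p = (x, y)" by (cases p)
    have y: "y \<in> T x" and xy: "dist x y \<le> \<delta> * r ^ n"
      using that by (simp_all add: P_def p)
    show ?thesis
    proof (cases "x = y")
      case True
      \<comment> \<open>Here \<open>y\<close> is already a fixed point, and the orbit stays there.\<close>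
      then have "P (Suc n) (y, y)"
        using y r \<open>\<delta> > 0\<close> by (simp add: P_def)
      then show ?thesis using p by auto
    next
      case False
      have "\<delta> * r ^ n \<le> \<delta> * 1"
        using \<open>\<delta> > 0\<close> r by (intro mult_left_mono power_le_one) auto
      with xy have "dist x y \<le> \<delta>" by simp
      have "infdist y (T y) \<le> hausdorff_dist (T x) (T y)"
        using T_CB y by (intro infdist_le_hausdorff_dist)
      also have "\<dots> \<le> k * dist x y"
        using contr False \<open>dist x y \<le> \<delta>\<close> by blast
      also have "\<dots> < r * dist x y" using False r by simp
      finally have "infdist y (T y) < r * dist x y" .
      moreover have "T y \<noteq> {}" using T_CB[of y] by (simp add: CB_def)
      ultimately obtain z where z: "z \<in> T y" "dist y z < r * dist x y"
        using ex_dist_less_if_infdist_less by blast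
      have "r * dist x y \<le> r * (\<delta> * r ^ n)" using xy r by simp
      with z have "P (Suc n) (y, z)" by (simp add: P_def mult_ac)
      then show ?thesis using p by auto
    qed
  qed
  moreover have "P 0 (x0, x1)" using start by (simp add: P_def)
  ultimately have "\<exists>f. \<forall>n. P n (f n) \<and> fst (f (Suc n)) = snd (f n)"
    by (intro dependent_nat_choice) blast
  then obtain f where f: "\<And>n. P n (f n)" "\<And>n. fst (f (Suc n)) = snd (f n)"
    by blast
  define x where "x n = fst (f n)" for n
  have orbit: "x (Suc n) \<in> T (x n)" and step: "dist (x n) (x (Suc n)) \<le> \<delta> * r ^ n" for n
    using f by (auto simp: x_def P_def)
  have "summable (\<lambda>n. \<delta> * r ^ n)"
    using r by (intro summable_mult summable_geometric) simp
  then have "summable (\<lambda>n. dist (x n) (x (Suc n)))"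
    by (rule summable_comparison_test') (use step in simp)
  then have "convergent x"
    using Cauchy_if_summable_dist Cauchy_convergent by blast
  then obtain v where v: "x \<longlonglongrightarrow> v" by (auto simp: convergent_def)
  then have lim0: "(\<lambda>n. dist (x n) v) \<longlonglongrightarrow> 0"
    by (rule tendsto_dist_iff[THEN iffD1])
  have bound: "\<forall>\<^sub>F n in sequentially. infdist v (T v) \<le> dist (x n) v + dist (x (Suc n)) v"
    using tendstoD[OF v \<open>\<delta> > 0\<close>]
  proof eventually_elim
    case (elim n)
    have "infdist (x (Suc n)) (T v) \<le> dist (x n) v"
    proof (cases "x n = v")
      case True
      then show ?thesis using orbit[of n] by simp
    next
      case False
      have "infdist (x (Suc n)) (T v) \<le> hausdorff_dist (T (x n)) (T v)"
        using T_CB orbit by (intro infdist_le_hausdorff_dist)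
      also have "\<dots> \<le> k * dist (x n) v" using contr False elim by simp
      also have "\<dots> \<le> 1 * dist (x n) v" using k by (intro mult_right_mono) auto
      finally show ?thesis by simp
    qed
    then show ?case
      using infdist_triangle[of v "T v" "x (Suc n)"] by (simp add: dist_commute)
  qed
  have "(\<lambda>n. dist (x n) v + dist (x (Suc n)) v) \<longlonglongrightarrow> 0"
    using tendsto_add[OF lim0 LIMSEQ_Suc[OF lim0]] by simp
  then have "infdist v (T v) \<le> 0"
    using bound by (rule tendsto_lowerbound) simp
  then have "infdist v (T v) = 0" by (simp add: infdist_nonneg order_antisym)
  moreover have "closed (T v)" "T v \<noteq> {}"
    using T_CB[of v] by (simp_all add: CB_def)
  ultimately have "v \<in> T v"
    by (simp add: in_closed_iff_infdist_zero)
  then show ?thesis by blast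
qed

theorem corollary2p5:
  fixes T :: "'a::complete_space \<Rightarrow> 'a set"
    and \<theta> :: "real \<Rightarrow> real"
  assumes T_CB: "\<And>x. T x \<in> CB"
    and \<theta>_pos: "\<And>t. t > 0 \<Longrightarrow> \<theta> t > 0"
    and \<theta>_usc: "upper_semicontinuous_on {0<..} \<theta>"
    and \<theta>_ratio: "antimono_on {0<..} (\<lambda>t. \<theta> t / t)"
    and contr: "\<And>x y. x \<noteq> y \<Longrightarrow>
      hausdorff_dist (T x) (T y) \<le> dist x y - \<theta> (dist x y)"
  shows "\<exists>v. v \<in> T v"
proof -
  fix x0 :: 'a
  obtain x1 where x1: "x1 \<in> T x0"
    using T_CB[of x0] by (auto simp: CB_def)
  show ?thesis
  proof (cases "x0 = x1")
    case True
    with x1 show ?thesis by blast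
  next
    case False
    define \<delta> where "\<delta> = dist x0 x1"
    have "\<delta> > 0" using False by (simp add: \<delta>_def)
    define c where "c = \<theta> \<delta> / \<delta>"
    have "c > 0" using \<open>\<delta> > 0\<close> \<theta>_pos by (simp add: c_def)
    \<comment> \<open>The inequality for \<open>x0\<close> and \<open>x1\<close> forces \<open>c \<le> 1\<close>; the maximum saves this argument.\<close>
    define k where "k = max 0 (1 - c)"
    have "hausdorff_dist (T x) (T y) \<le> k * dist x y" if "x \<noteq> y" "dist x y \<le> \<delta>" for x y
    proof -
      have "dist x y > 0" using that by simp
      then have "c \<le> \<theta> (dist x y) / dist x y"
        unfolding c_def
        using monotone_onD[OF \<theta>_ratio, of "dist x y" \<delta>] that \<open>\<delta> > 0\<close> by simp
      then have "c * dist x y \<le> \<theta> (dist x y)"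
        using \<open>dist x y > 0\<close> by (simp add: pos_le_divide_eq)
      then have "hausdorff_dist (T x) (T y) \<le> (1 - c) * dist x y"
        using contr[OF that(1)] by (simp add: algebra_simps)
      also have "\<dots> \<le> k * dist x y"
        by (intro mult_right_mono) (auto simp: k_def)
      finally show ?thesis .
    qed
    moreover have "0 \<le> k" "k < 1" using \<open>c > 0\<close> by (auto simp: k_def)
    moreover have "dist x0 x1 \<le> \<delta>" by (simp add: \<delta>_def)
    ultimately show ?thesis
      using T_CB x1 by (intro fixed_point_if_contraction_at_small_scale)
  qed
qed

end
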